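(* Let $\mathbf{k}$ be a unitary commutative ring, $\Omega$ a nonempty set, and let $(\mathfrak{g},[\,,\,],\{P_\omega\mid\omega\in\Omega\})$ be a matching Rota-Baxter Lie algebra of weight zero (that is, $\lambda_\omega=0$ for all $\omega\in\Omega$). Define $$x\ast_\omega y:=[P_\omega(x),y],\qquad x,y\in\mathfrak{g},\ \omega\in\Omega .$$ Then $(\mathfrak{g},\{\ast_\omega\mid\omega\in\Omega\})$ is a matching pre-Lie algebra.
   Context: All modules are over $\mathbf{k}$ and all binary operations are $\mathbf{k}$-bilinear. Given scalars $\lambda_\Omega=\{\lambda_\omega\mid\omega\in\Omega\}\subseteq\mathbf{k}$, a matching Rota-Baxter Lie algebra of weight $\lambda_\Omega$ is a Lie algebra $(\mathfrak{g},[\,,\,])$ over $\mathbf{k}$ with linear operators $P_\omega:\mathfrak{g}\to\mathfrak{g}$, $\omega\in\Omega$, such that $$[P_\alpha(x),P_\beta(y)]=P_\alpha([x,P_\beta(y)])+P_\beta([P_\alpha(x),y])+\lambda_\beta P_\alpha([x,y])\quad\text{for all }x,y\in\mathfrak{g},\ \alpha,\beta\in\Omega .$$ A matching (left) pre-Lie algebra is a module $A$ with binary operations $\{\ast_\omega\mid\omega\in\Omega\}$ such that $$x\ast_\alpha(y\ast_\beta z)-(x\ast_\alpha y)\ast_\beta z=y\ast_\beta(x\ast_\alpha z)-(y\ast_\beta x)\ast_\alpha z\quad\text{for all }x,y,z\in A,\ \alpha,\beta\in\Omega .$$ *)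

theory Defs
  imports "HOL-Algebra.Module"
begin

text \<open>
  A module \<open>M\<close> over a commutative ring \<open>R\<close> (with \<open>cring\<close> admitting the zero ring) is a
  \<^locale>\<open>module\<close>. The record \<open>M\<close> also has ring multiplication and unit fields; \<open>module R M\<close> does not
  constrain them and they play no role here. Further operations are functions on the element type,
  relevant only on \<open>carrier M\<close>; likewise indexed families are relevant only on the index set.
\<close>

definition linear_operator ::
    "('k, 'm) ring_scheme \<Rightarrow> ('k, 'a, 'n) module_scheme \<Rightarrow> ('a \<Rightarrow> 'a) \<Rightarrow> bool" where
  "linear_operator R M f \<longleftrightarrow>
     f \<in> carrier M \<rightarrow> carrier M \<and>
     (\<forall>x\<in>carrier M. \<forall>y\<in>carrier M. f (x \<oplus>\<^bsub>M\<^esub> y) = f x \<oplus>\<^bsub>M\<^esub> f y) \<and>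
     (\<forall>c\<in>carrier R. \<forall>x\<in>carrier M. f (c \<odot>\<^bsub>M\<^esub> x) = c \<odot>\<^bsub>M\<^esub> f x)"

definition bilinear_operation ::
    "('k, 'm) ring_scheme \<Rightarrow> ('k, 'a, 'n) module_scheme \<Rightarrow> ('a \<Rightarrow> 'a \<Rightarrow> 'a) \<Rightarrow> bool" where
  "bilinear_operation R M f \<longleftrightarrow>
     (\<forall>x\<in>carrier M. linear_operator R M (\<lambda>y. f x y)) \<and>
     (\<forall>y\<in>carrier M. linear_operator R M (\<lambda>x. f x y))"

text \<open>The bracket is alternating, which over a general ring is stronger than antisymmetric.\<close>

locale lie_algebra = module R M
  for R :: "('k, 'm) ring_scheme" (structure)
    and M :: "('k, 'a, 'n) module_scheme" (structure) +
  fixes br :: "'a \<Rightarrow> 'a \<Rightarrow> 'a"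
  assumes bracket_bilinear: "bilinear_operation R M br"
    and bracket_alternating: "x \<in> carrier M \<Longrightarrow> br x x = \<zero>\<^bsub>M\<^esub>"
    and jacobi: "\<lbrakk>x \<in> carrier M; y \<in> carrier M; z \<in> carrier M\<rbrakk> \<Longrightarrow>
      br x (br y z) \<oplus>\<^bsub>M\<^esub> br y (br z x) \<oplus>\<^bsub>M\<^esub> br z (br x y) = \<zero>\<^bsub>M\<^esub>"

locale matching_rota_baxter_lie_algebra = lie_algebra R M br
  for R :: "('k, 'm) ring_scheme" (structure)
    and M :: "('k, 'a, 'n) module_scheme" (structure)
    and br :: "'a \<Rightarrow> 'a \<Rightarrow> 'a" +
  fixes \<Omega> :: "'w set"
    and wt :: "'w \<Rightarrow> 'k"
    and P :: "'w \<Rightarrow> 'a \<Rightarrow> 'a"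
  assumes weight_closed: "\<omega> \<in> \<Omega> \<Longrightarrow> wt \<omega> \<in> carrier R"
    and operator_linear: "\<omega> \<in> \<Omega> \<Longrightarrow> linear_operator R M (P \<omega>)"
    and matching_rota_baxter:
      "\<lbrakk>\<alpha> \<in> \<Omega>; \<beta> \<in> \<Omega>; x \<in> carrier M; y \<in> carrier M\<rbrakk> \<Longrightarrow>
        br (P \<alpha> x) (P \<beta> y) =
          P \<alpha> (br x (P \<beta> y)) \<oplus>\<^bsub>M\<^esub> P \<beta> (br (P \<alpha> x) y) \<oplus>\<^bsub>M\<^esub> wt \<beta> \<odot>\<^bsub>M\<^esub> P \<alpha> (br x y)"

locale matching_pre_lie_algebra = module R M
  for R :: "('k, 'm) ring_scheme" (structure)
    and M :: "('k, 'a, 'n) module_scheme" (structure) +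
  fixes \<Omega> :: "'w set"
    and pl :: "'w \<Rightarrow> 'a \<Rightarrow> 'a \<Rightarrow> 'a"
  assumes operation_bilinear: "\<omega> \<in> \<Omega> \<Longrightarrow> bilinear_operation R M (pl \<omega>)"
    and matching_pre_lie:
      "\<lbrakk>\<alpha> \<in> \<Omega>; \<beta> \<in> \<Omega>; x \<in> carrier M; y \<in> carrier M; z \<in> carrier M\<rbrakk> \<Longrightarrow>
        pl \<alpha> x (pl \<beta> y z) \<ominus>\<^bsub>M\<^esub> pl \<beta> (pl \<alpha> x y) z =
        pl \<beta> y (pl \<alpha> x z) \<ominus>\<^bsub>M\<^esub> pl \<alpha> (pl \<beta> y x) z"

end

theory Submission
  imports Defs
begin

text \<open>
  With \<open>a = P \<alpha> x\<close> and \<open>b = P \<beta> y\<close>, the Jacobi identity reads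
  \<open>[a,[b,z]] - [b,[a,z]] = [[a,b],z]\<close>, while the Rota-Baxter identity of weight zero
  turns \<open>[a,b]\<close> into \<open>P \<beta> [a,y] - P \<alpha> [b,x]\<close>; bracketing with \<open>z\<close> and rearranging gives the claim.
\<close>

lemma linear_operator_closed:
  "linear_operator R M f \<Longrightarrow> x \<in> carrier M \<Longrightarrow> f x \<in> carrier M"
  by (auto simp: linear_operator_def)

lemma linear_operator_add:
  "linear_operator R M f \<Longrightarrow> x \<in> carrier M \<Longrightarrow> y \<in> carrier M \<Longrightarrow>
    f (x \<oplus>\<^bsub>M\<^esub> y) = f x \<oplus>\<^bsub>M\<^esub> f y"
  by (auto simp: linear_operator_def)

lemma linear_operator_comp:
  "linear_operator R M f \<Longrightarrow> linear_operator R M g \<Longrightarrow> linear_operator R M (\<lambda>x. f (g x))"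
  by (auto simp: linear_operator_def Pi_iff)

text \<open>Negation is scalar multiplication by \<open>\<ominus> \<one>\<close>, so homogeneity of
  \<open>f\<close> carries it through.\<close>

lemma (in module) linear_operator_minus:
  assumes f: "linear_operator R M f" and x: "x \<in> carrier M"
  shows "f (\<ominus>\<^bsub>M\<^esub> x) = \<ominus>\<^bsub>M\<^esub> f x"
proof -
  have "f (\<ominus>\<^bsub>M\<^esub> x) = f ((\<ominus> \<one>) \<odot>\<^bsub>M\<^esub> x)"
    using x by (simp add: smult_l_minus)
  also have "\<dots> = (\<ominus> \<one>) \<odot>\<^bsub>M\<^esub> f x"
    using f x by (simp add: linear_operator_def)
  also have "\<dots> = \<ominus>\<^bsub>M\<^esub> f x"
    using f x by (simp add: smult_l_minus linear_operator_closed)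
  finally show ?thesis .
qed

context lie_algebra
begin

lemma bracket_linear_right: "x \<in> carrier M \<Longrightarrow> linear_operator R M (br x)"
  using bracket_bilinear by (simp add: bilinear_operation_def)

lemma bracket_linear_left: "y \<in> carrier M \<Longrightarrow> linear_operator R M (\<lambda>x. br x y)"
  using bracket_bilinear by (simp add: bilinear_operation_def)

lemma bracket_closed: "x \<in> carrier M \<Longrightarrow> y \<in> carrier M \<Longrightarrow> br x y \<in> carrier M"
  using bracket_linear_right by (rule linear_operator_closed)

text \<open>Polarization: expanding the alternating law at \<open>x \<oplus> y\<close> leaves only
  the two mixed terms, which must cancel.\<close>

lemma bracket_antisym:
  assumes x: "x \<in> carrier M" and y: "y \<in> carrier M"
  shows "br x y = \<ominus>\<^bsub>M\<^esub> br y x"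
proof -
  have "\<zero>\<^bsub>M\<^esub> = br (x \<oplus>\<^bsub>M\<^esub> y) (x \<oplus>\<^bsub>M\<^esub> y)"
    using x y by (simp add: bracket_alternating)
  also have "\<dots> = br x (x \<oplus>\<^bsub>M\<^esub> y) \<oplus>\<^bsub>M\<^esub> br y (x \<oplus>\<^bsub>M\<^esub> y)"
    using linear_operator_add[OF bracket_linear_left x y] x y by simp
  also have "\<dots> = br x y \<oplus>\<^bsub>M\<^esub> br y x"
    using x y
    by (simp add: linear_operator_add[OF bracket_linear_right] bracket_alternating bracket_closed)
  finally show ?thesis
    using x y by (metis M.minus_equality bracket_closed)
qed

text \<open>This is the Jacobi identity in derivation form: bracketing with \<open>a\<close> acts by
  the product rule. It isolates \<open>br (br a b) z\<close>, into which the Rota-Baxter identity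
  can be substituted.\<close>

lemma bracket_leibniz:
  assumes a: "a \<in> carrier M" and b: "b \<in> carrier M" and z: "z \<in> carrier M"
  shows "br a (br b z) = br b (br a z) \<oplus>\<^bsub>M\<^esub> br (br a b) z"
proof -
  note cl = a b z bracket_closed
  \<comment> \<open>Antisymmetry swaps the inner bracket; linearity of \<open>br b\<close> then
    pulls the sign out.\<close>
  have "br b (br z a) = \<ominus>\<^bsub>M\<^esub> br b (br a z)"
    using cl by (metis bracket_antisym linear_operator_minus[OF bracket_linear_right])
  moreover have "br z (br a b) = \<ominus>\<^bsub>M\<^esub> br (br a b) z"
    using cl by (metis bracket_antisym)
  ultimately have
    "br a (br b z) \<oplus>\<^bsub>M\<^esub> (\<ominus>\<^bsub>M\<^esub> (br b (br a z) \<oplus>\<^bsub>M\<^esub> br (br a b) z)) = \<zero>\<^bsub>M\<^esub>"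
    using jacobi[OF a b z] cl by (simp add: M.minus_add M.a_assoc)
  \<comment> \<open>Additive inverses are unique, so the left summand is the double negative of the
    desired right-hand side.\<close>
  from M.minus_equality[OF this] show ?thesis
    using cl by simp
qed

end

theorem theorem4p7:
  fixes R :: "('k, 'm) ring_scheme"
    and \<gg> :: "('k, 'a, 'n) module_scheme"
    and br :: "'a \<Rightarrow> 'a \<Rightarrow> 'a"
    and \<Omega> :: "'w set"
    and wt :: "'w \<Rightarrow> 'k"
    and P :: "'w \<Rightarrow> 'a \<Rightarrow> 'a"
  assumes "\<Omega> \<noteq> {}"
    and "matching_rota_baxter_lie_algebra R \<gg> br \<Omega> wt P"
    and "\<And>\<omega>. \<omega> \<in> \<Omega> \<Longrightarrow> wt \<omega> = \<zero>\<^bsub>R\<^esub>"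
  shows "matching_pre_lie_algebra R \<gg> \<Omega> (\<lambda>\<omega> x y. br (P \<omega> x) y)"
proof -
  interpret matching_rota_baxter_lie_algebra R \<gg> br \<Omega> wt P by fact
  note P_closed = linear_operator_closed[OF operator_linear]
  show ?thesis
  proof unfold_locales
    fix \<omega> assume w: "\<omega> \<in> \<Omega>"
    then show "bilinear_operation R \<gg> (\<lambda>x y. br (P \<omega> x) y)"
      unfolding bilinear_operation_def
      \<comment> \<open>In \<open>x\<close> the operation is the composite of
        \<open>P \<omega>\<close> with a bracket that is linear on the left; in \<open>y\<close> it
        is bracketing with the fixed element \<open>P \<omega> x\<close>.\<close>
      by (auto intro: bracket_linear_right P_closed
          linear_operator_comp[OF bracket_linear_left operator_linear])
  next
    fix \<alpha> \<beta> x y z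
    assume \<alpha>: "\<alpha> \<in> \<Omega>" and \<beta>: "\<beta> \<in> \<Omega>"
      and x: "x \<in> carrier \<gg>" and y: "y \<in> carrier \<gg>" and z: "z \<in> carrier \<gg>"
    define a b where "a = P \<alpha> x" and "b = P \<beta> y"
    have a: "a \<in> carrier \<gg>" and b: "b \<in> carrier \<gg>"
      using \<alpha> \<beta> x y by (simp_all add: a_def b_def P_closed)
    \<comment> \<open>These are the products of \<open>x\<close> with \<open>y\<close> under
      \<alpha> and of \<open>y\<close> with \<open>x\<close> under \<beta>, with
      \<open>P \<beta>\<close> and \<open>P \<alpha>\<close> applied, as they occur in the
      goal.\<close>
    define u v where "u = P \<beta> (br a y)" and "v = P \<alpha> (br b x)"
    have u: "u \<in> carrier \<gg>" and v: "v \<in> carrier \<gg>"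
      using \<alpha> \<beta> a b x y by (simp_all add: u_def v_def P_closed bracket_closed)
    \<comment> \<open>The Rota-Baxter identity yields \<open>br x b\<close>, whereas
      \<open>v\<close> contains \<open>br b x\<close>; this sign puts the \<open>v\<close> term on
      the other side of the goal.\<close>
    have "P \<alpha> (br x b) = \<ominus>\<^bsub>\<gg>\<^esub> v"
      using bracket_antisym[OF x b] linear_operator_minus[OF operator_linear[OF \<alpha>]] b x
      by (simp add: v_def bracket_closed)
    \<comment> \<open>Weight zero enters only here, where it removes the term with
      \<open>wt \<beta>\<close>.\<close>
    then have "br a b = \<ominus>\<^bsub>\<gg>\<^esub> v \<oplus>\<^bsub>\<gg>\<^esub> u"
      using matching_rota_baxter[OF \<alpha> \<beta> x y] assms(3)[OF \<beta>] u v \<alpha> x y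
      by (simp add: a_def b_def u_def smult_l_null P_closed bracket_closed)
    then have "br (br a b) z = \<ominus>\<^bsub>\<gg>\<^esub> br v z \<oplus>\<^bsub>\<gg>\<^esub> br u z"
      using linear_operator_add[OF bracket_linear_left[OF z], of "\<ominus>\<^bsub>\<gg>\<^esub> v" u]
        linear_operator_minus[OF bracket_linear_left[OF z] v] u v by simp
    then have "br a (br b z) = br b (br a z) \<oplus>\<^bsub>\<gg>\<^esub> (\<ominus>\<^bsub>\<gg>\<^esub> br v z \<oplus>\<^bsub>\<gg>\<^esub> br u z)"
      using bracket_leibniz[OF a b z] by simp
    \<comment> \<open>Subtracting \<open>br u z\<close> from both sides cancels it on the
      right.\<close>
    then have "br a (br b z) \<ominus>\<^bsub>\<gg>\<^esub> br u z = br b (br a z) \<ominus>\<^bsub>\<gg>\<^esub> br v z"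
      using a b u v z by (simp add: M.minus_eq M.a_assoc M.r_neg bracket_closed)
    then show "br (P \<alpha> x) (br (P \<beta> y) z) \<ominus>\<^bsub>\<gg>\<^esub> br (P \<beta> (br (P \<alpha> x) y)) z =
        br (P \<beta> y) (br (P \<alpha> x) z) \<ominus>\<^bsub>\<gg>\<^esub> br (P \<alpha> (br (P \<beta> y) x)) z"
      by (simp add: a_def b_def u_def v_def)
  qed
qed

end
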